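(* Let $k\ge 1$ and $N\ge 2k+1$ be integers, let $\lambda_1,\dots,\lambda_k$ be real parameters which are all smaller than one in absolute value, and let $H=H^{(N)}(\lambda_1,\dots,\lambda_k)$ be the real tridiagonal $N\times N$ matrix defined in the context. Put $f(x):=(1-x)/(1+x)$. Then $H$ is self-adjoint in the Hilbert space $\mathcal{H}^{(S)}\sim\mathbb{R}^N$ whose inner product is $\langle\psi|\phi\rangle^{(S)}=\psi^{T}\Theta^{(diag)}\phi$, that is, $H^{T}\Theta^{(diag)}=\Theta^{(diag)}H$, where $\Theta^{(diag)}\neq I$ is the diagonal non-Dirac Hilbert-space metric which differs from the unit matrix $I$ just by its $2k$ outermost diagonal matrix elements $$\Theta^{(diag)}_{k,k}=\Theta^{(diag)}_{N+1-k,\,N+1-k}=f(\lambda_k),$$ $$\Theta^{(diag)}_{k-1,k-1}=\Theta^{(diag)}_{N+2-k,\,N+2-k}=f(\lambda_k)f(\lambda_{k-1}),$$ $$\ldots,$$ $$\Theta^{(diag)}_{1,1}=\Theta^{(diag)}_{N,N}=f(\lambda_k)f(\lambda_{k-1})\cdots f(\lambda_1),$$ i.e. $\Theta^{(diag)}_{jj}=\Theta^{(diag)}_{N+1-j,\,N+1-j}=\prod_{i=j}^{k}f(\lambda_i)$ for $j=1,\dots,k$, all the other diagonal elements being equal to $1$.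
   Context: For integers $k\ge1$, $N\ge 2k+1$ and real $\lambda_1,\dots,\lambda_k$, the matrix $H=H^{(N)}(\lambda_1,\dots,\lambda_k)$ is the real $N\times N$ tridiagonal matrix (all entries $H_{ij}$ with $|i-j|>1$ are zero) with $H_{jj}=2$ for all $j=1,\dots,N$; with $$H_{j,j+1}=-1-\lambda_j,\quad H_{j+1,j}=-1+\lambda_j,\quad H_{N-j,\,N-j+1}=-1+\lambda_j,\quad H_{N-j+1,\,N-j}=-1-\lambda_j\qquad (j=1,\dots,k);$$ and with all remaining entries of the first upper and first lower diagonals (i.e. $H_{j,j+1}$ and $H_{j+1,j}$ for $k<j<N-k$) equal to $-1$. A Hilbert-space metric on $\mathbb{R}^N$ is a symmetric positive definite matrix $\Theta$; it is called non-Dirac if $\Theta\neq I$. A real matrix $H$ is self-adjoint with respect to the inner product $\langle\psi|\phi\rangle^{(S)}=\psi^T\Theta\phi$ if $\langle\psi|H\phi\rangle^{(S)}=\langle H\psi|\phi\rangle^{(S)}$ for all $\psi,\phi\in\mathbb{R}^N$, equivalently $H^T\Theta=\Theta H$.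
   Formalization: The claim Θ^(diag) ≠ I is stated only when some λ_j is nonzero, since for λ_1=…=λ_k=0 one has f(0)=1 and Θ^(diag)=I; all other claims are stated for all |λ_j|<1. *)

theory Defs
  imports Complex_Main "Jordan_Normal_Form.Matrix"
begin

text \<open>
  Matrices of type \<open>real mat\<close> are indexed from 0. The functions \<open>H_entry\<close> and
  \<open>Theta_entry\<close> use indices ranging over \<open>1..N\<close>; the shift happens only in
  \<open>H_mat\<close> and \<open>Theta_diag\<close>. A parameter tuple is a function of type \<open>nat \<Rightarrow> real\<close>
  of which only the values at \<open>1..k\<close> are used.
\<close>

text \<open>
  The third and fourth cases of \<open>H_entry\<close> prescribe the entries \<open>(j, j+1)\<close> and \<open>(j+1, j)\<close>
  with \<open>j \<le> k\<close>. The fifth and sixth prescribe \<open>(N-j, N-j+1)\<close> and \<open>(N-j+1, N-j)\<close> with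
  \<open>j \<le> k\<close>, where \<open>j\<close> is recovered from the smaller index. The cases are disjoint if
  \<open>N \<ge> 2 * k + 1\<close>.
\<close>

definition H_entry :: "nat \<Rightarrow> nat \<Rightarrow> (nat \<Rightarrow> real) \<Rightarrow> nat \<Rightarrow> nat \<Rightarrow> real" where
  "H_entry N k lam r c =
    (if r = c then 2
     else if r \<noteq> c + 1 \<and> c \<noteq> r + 1 then 0
     else if c = r + 1 \<and> r \<le> k then - 1 - lam r
     else if r = c + 1 \<and> c \<le> k then - 1 + lam c
     else if c = r + 1 \<and> N - k \<le> r then - 1 + lam (N - r)
     else if r = c + 1 \<and> N - k \<le> c then - 1 - lam (N - c)
     else - 1)"

definition H_mat :: "nat \<Rightarrow> nat \<Rightarrow> (nat \<Rightarrow> real) \<Rightarrow> real mat" where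
  "H_mat N k lam = mat N N (\<lambda>(r, c). H_entry N k lam (r + 1) (c + 1))"

definition f_ratio :: "real \<Rightarrow> real" where
  "f_ratio x = (1 - x) / (1 + x)"

definition Theta_entry :: "nat \<Rightarrow> nat \<Rightarrow> (nat \<Rightarrow> real) \<Rightarrow> nat \<Rightarrow> nat \<Rightarrow> real" where
  "Theta_entry N k lam r c =
    (if r \<noteq> c then 0
     else if r \<le> k then (\<Prod>i = r..k. f_ratio (lam i))
     else if N + 1 - k \<le> r then (\<Prod>i = N + 1 - r..k. f_ratio (lam i))
     else 1)"

definition Theta_diag :: "nat \<Rightarrow> nat \<Rightarrow> (nat \<Rightarrow> real) \<Rightarrow> real mat" where
  "Theta_diag N k lam = mat N N (\<lambda>(r, c). Theta_entry N k lam (r + 1) (c + 1))"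

definition hilbert_metric :: "nat \<Rightarrow> real mat \<Rightarrow> bool" where
  "hilbert_metric N Theta \<longleftrightarrow>
     Theta \<in> carrier_mat N N \<and> transpose_mat Theta = Theta \<and>
     (\<forall>v \<in> carrier_vec N. v \<noteq> 0\<^sub>v N \<longrightarrow> v \<bullet> (Theta *\<^sub>v v) > 0)"

definition metric_inner :: "real mat \<Rightarrow> real vec \<Rightarrow> real vec \<Rightarrow> real" where
  "metric_inner Theta psi phi = psi \<bullet> (Theta *\<^sub>v phi)"

definition self_adjoint_wrt :: "nat \<Rightarrow> real mat \<Rightarrow> real mat \<Rightarrow> bool" where
  "self_adjoint_wrt N Theta A \<longleftrightarrow>
     (\<forall>psi \<in> carrier_vec N. \<forall>phi \<in> carrier_vec N.
        metric_inner Theta psi (A *\<^sub>v phi) = metric_inner Theta (A *\<^sub>v psi) phi)"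

end

theory Submission
  imports Defs
begin

text \<open>
  A diagonal matrix \<open>diag(w)\<close> intertwines \<open>H\<close> with its transpose iff
  \<open>w r * H r c = w c * H c r\<close> for all \<open>r\<close>, \<open>c\<close>. For tridiagonal \<open>H\<close> only neighbouring indices
  matter, so the ratios of successive weights are forced to be those of the off-diagonal entries,
  which are \<open>f (\<lambda>\<^sub>j)\<close> or its inverse at the two ends and \<open>1\<close> in between. The symmetric
  arrangement of the couplings lets the products on both sides meet at the common value \<open>1\<close>.
\<close>

lemma metric_inner_mat_diag:
  assumes "u \<in> carrier_vec n" "v \<in> carrier_vec n"
  shows "metric_inner (mat_diag n w) u v = (\<Sum>i<n. w i * (u $ i * v $ i))"
proof -
  have "(mat_diag n w *\<^sub>v v) $ i = w i * v $ i" if "i < n" for i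
  proof -
    have "(mat_diag n w *\<^sub>v v) $ i = (\<Sum>j<n. (if i = j then w j else 0) * v $ j)"
      using that assms by (simp add: mat_diag_def scalar_prod_def lessThan_atLeast0)
    also have "\<dots> = w i * v $ i"
      using that by (simp add: if_distrib [of "\<lambda>x. x * _"] sum.delta cong: if_cong)
    finally show ?thesis .
  qed
  then show ?thesis
    using assms
    by (auto simp: metric_inner_def scalar_prod_def lessThan_atLeast0 mat_diag_def ac_simps
        intro!: sum.cong)
qed

text \<open>The quadratic form is a sum of squares of the coordinates with positive weights, and a
  nonzero vector has a coordinate whose term is strictly positive.\<close>

lemma hilbert_metric_mat_diag:
  assumes "\<And>i. i < n \<Longrightarrow> w i > 0"
  shows "hilbert_metric n (mat_diag n w)"
proof -
  have "v \<bullet> (mat_diag n w *\<^sub>v v) > 0" if v: "v \<in> carrier_vec n" "v \<noteq> 0\<^sub>v n" for v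
  proof -
    obtain i where i: "i < n" "v $ i \<noteq> 0"
      using v by (metis carrier_vecD eq_vecI index_zero_vec)
    have "(\<Sum>i<n. w i * (v $ i * v $ i)) > 0"
    proof (rule sum_pos2 [of _ i])
      show "0 < w i * (v $ i * v $ i)"
        using assms [of i] i by (metis mult_pos_pos not_real_square_gt_zero)
      show "0 \<le> w j * (v $ j * v $ j)" if "j \<in> {..<n}" for j
        using assms [of j] that by simp
    qed (use i in auto)
    then show ?thesis
      using metric_inner_mat_diag [OF v(1) v(1)] by (simp add: metric_inner_def)
  qed
  moreover have "transpose_mat (mat_diag n w) = mat_diag n w"
    by (rule eq_matI) (auto simp: mat_diag_def)
  ultimately show ?thesis
    by (auto simp: hilbert_metric_def mat_diag_def)
qed

text \<open>Moving \<open>A\<close> across the dot product turns it into its transpose, so both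
  inner products equal
  \<open>u \<bullet> (transpose_mat A *\<^sub>v (T *\<^sub>v v))\<close>.\<close>

lemma self_adjoint_wrt_if_intertwines:
  assumes T: "T \<in> carrier_mat n n" and A: "A \<in> carrier_mat n n"
    and eq: "transpose_mat A * T = T * A"
  shows "self_adjoint_wrt n T A"
  unfolding self_adjoint_wrt_def
proof (intro ballI)
  fix u v :: "real vec"
  assume u: "u \<in> carrier_vec n" and v: "v \<in> carrier_vec n"
  have Tv: "T *\<^sub>v v \<in> carrier_vec n"
    using T v by simp
  have "T *\<^sub>v (A *\<^sub>v v) = transpose_mat A *\<^sub>v (T *\<^sub>v v)"
    using assoc_mult_mat_vec [OF T A v] assoc_mult_mat_vec [of "transpose_mat A" n n T n v] A T v eq
    by simp
  then show "metric_inner T u (A *\<^sub>v v) = metric_inner T (A *\<^sub>v u) v"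
    unfolding metric_inner_def
    using transpose_vec_mult_scalar [OF A u Tv] A T u v Tv
      comm_scalar_prod [of u n "transpose_mat A *\<^sub>v (T *\<^sub>v v)"]
      comm_scalar_prod [of "A *\<^sub>v u" n "T *\<^sub>v v"]
    by auto
qed

lemma f_ratio_pos: "\<bar>x\<bar> < 1 \<Longrightarrow> f_ratio x > 0"
  by (auto simp: f_ratio_def)

lemma f_ratio_eq_1_iff: "\<bar>x\<bar> < 1 \<Longrightarrow> f_ratio x = 1 \<longleftrightarrow> x = 0"
  by (auto simp: f_ratio_def field_simps)

text \<open>This is what singles out \<open>f_ratio\<close>: it is the ratio of the two entries of a
  coupled off-diagonal pair.\<close>

lemma f_ratio_balance: "\<bar>x\<bar> < 1 \<Longrightarrow> f_ratio x * (- 1 - x) = - 1 + x"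
  by (auto simp: f_ratio_def field_simps)

lemma Theta_diag_eq_mat_diag:
  "Theta_diag N k lam = mat_diag N (\<lambda>i. Theta_entry N k lam (i + 1) (i + 1))"
  by (rule eq_matI) (auto simp: Theta_diag_def mat_diag_def Theta_entry_def)

lemma Theta_entry_pos:
  assumes lam: "\<And>j. j \<in> {1..k} \<Longrightarrow> \<bar>lam j\<bar> < 1" and "1 \<le> r" "r \<le> N"
  shows "Theta_entry N k lam r r > 0"
  using assms by (auto simp: Theta_entry_def intro!: prod_pos f_ratio_pos)

text \<open>The range includes \<open>j = k + 1\<close>, where the empty product gives the first
  unmodified weight 1. The balance at the boundary \<open>r = k\<close> then needs no separate
  case.\<close>

lemma Theta_entry_lower_end:
  assumes "2 * k + 1 \<le> N" "1 \<le> j" "j \<le> k + 1"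
  shows "Theta_entry N k lam j j = (\<Prod>i = j..k. f_ratio (lam i))"
  using assms by (auto simp: Theta_entry_def)

lemma Theta_entry_upper_end:
  assumes "2 * k + 1 \<le> N" "1 \<le> j" "j \<le> k + 1"
  shows "Theta_entry N k lam (N + 1 - j) (N + 1 - j) = (\<Prod>i = j..k. f_ratio (lam i))"
  using assms by (auto simp: Theta_entry_def)

lemma Theta_H_balance_Suc:
  assumes N: "2 * k + 1 \<le> N" and lam: "\<And>j. j \<in> {1..k} \<Longrightarrow> \<bar>lam j\<bar> < 1"
    and r: "1 \<le> r" "r < N"
  shows "Theta_entry N k lam r r * H_entry N k lam r (Suc r) =
    Theta_entry N k lam (Suc r) (Suc r) * H_entry N k lam (Suc r) r"
proof -
  define P where "P j = (\<Prod>i = j..k. f_ratio (lam i))" for j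
  \<comment> \<open>Splitting off the first factor gives
    \<open>P j = f_ratio (lam j) * P (Suc j)\<close>, which reduces the claim to
    \<open>f_ratio_balance\<close>.\<close>
  have P: "P j * (- 1 - lam j) = P (Suc j) * (- 1 + lam j)" if "1 \<le> j" "j \<le> k" for j
    using that f_ratio_balance [of "lam j"] lam [of j]
    by (simp add: P_def prod.atLeast_Suc_atMost mult.assoc mult.left_commute)
  consider "r \<le> k" | "k < r" "r < N - k" | "N - k \<le> r"
    by linarith
  then show ?thesis
  proof cases
    case 1
    then have "Theta_entry N k lam r r = P r" "Theta_entry N k lam (Suc r) (Suc r) = P (Suc r)"
      using Theta_entry_lower_end N r by (simp_all add: P_def)
    with P [of r] 1 r show ?thesis
      by (simp add: H_entry_def)
  next
    case 2
    \<comment> \<open>In the middle both weights are 1 and both entries are -1.\<close>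
    then show ?thesis
      using N by (auto simp: H_entry_def Theta_entry_def)
  next
    case 3
    \<comment> \<open>Reflection sends \<open>r\<close> and \<open>Suc r\<close> to
      \<open>Suc j\<close> and \<open>j\<close>. Weights and signs of the coupling both swap, so the
      claim is \<open>P\<close> read from right to left.\<close>
    define j where "j = N - r"
    have j: "1 \<le> j" "j \<le> k" "\<not> r \<le> k"
      using 3 r N by (auto simp: j_def)
    have r_eq: "r = N + 1 - Suc j" "Suc r = N + 1 - j"
      using r by (auto simp: j_def)
    have "Theta_entry N k lam r r = P (Suc j)" "Theta_entry N k lam (Suc r) (Suc r) = P j"
      using Theta_entry_upper_end [OF N, of "Suc j" lam, folded r_eq]
        Theta_entry_upper_end [OF N, of j lam, folded r_eq] j(1,2)
      by (simp_all add: P_def)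
    with P [of j] 3 j show ?thesis
      by (simp add: H_entry_def flip: j_def)
  qed
qed

lemma Theta_H_balance:
  assumes N: "2 * k + 1 \<le> N" and lam: "\<And>j. j \<in> {1..k} \<Longrightarrow> \<bar>lam j\<bar> < 1"
    and "1 \<le> r" "r \<le> N" "1 \<le> c" "c \<le> N"
  shows "Theta_entry N k lam r r * H_entry N k lam r c =
    Theta_entry N k lam c c * H_entry N k lam c r"
proof -
  consider "r = c" | "c = Suc r" | "r = Suc c" | "r \<noteq> c" "r \<noteq> Suc c" "c \<noteq> Suc r"
    by blast
  then show ?thesis
  proof cases
    case 2
    then show ?thesis
      using Theta_H_balance_Suc [OF N lam, where r = r] assms by simp
  next
    case 3
    then show ?thesis
      using Theta_H_balance_Suc [OF N lam, where r = c] assms by simp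
  qed (auto simp: H_entry_def)
qed

lemma Theta_diag_neq_one:
  assumes N: "2 * k + 1 \<le> N" and lam: "\<And>j. j \<in> {1..k} \<Longrightarrow> \<bar>lam j\<bar> < 1"
    and ex: "\<exists>j \<in> {1..k}. lam j \<noteq> 0"
  shows "Theta_diag N k lam \<noteq> 1\<^sub>m N"
proof
  assume one: "Theta_diag N k lam = 1\<^sub>m N"
  \<comment> \<open>At the largest index with a nonzero parameter, the product has a single factor other than 1.\<close>
  define j where "j = Max {j \<in> {1..k}. lam j \<noteq> 0}"
  have "j \<in> {j \<in> {1..k}. lam j \<noteq> 0}"
    unfolding j_def by (rule Max_in) (use ex in auto)
  then have j: "j \<in> {1..k}" "lam j \<noteq> 0"
    by auto
  have "lam i = 0" if "i \<in> {Suc j..k}" for i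
  proof (rule ccontr)
    assume "lam i \<noteq> 0"
    with that have "i \<le> j"
      unfolding j_def by (intro Max_ge) auto
    with that show False by simp
  qed
  then have "(\<Prod>i = Suc j..k. f_ratio (lam i)) = 1"
    by (intro prod.neutral) (simp add: f_ratio_def)
  then have "Theta_entry N k lam j j = f_ratio (lam j)"
    using j N by (simp add: Theta_entry_lower_end prod.atLeast_Suc_atMost)
  moreover have "j - 1 < N"
    using j N by auto
  then have "Theta_diag N k lam $$ (j - 1, j - 1) = Theta_entry N k lam j j"
      and "1\<^sub>m N $$ (j - 1, j - 1) = (1 :: real)"
    using j by (simp_all add: Theta_diag_def)
  ultimately have "f_ratio (lam j) = 1"
    using one by simp
  then show False
    using f_ratio_eq_1_iff lam j by blast
qed

theorem proposition1:
  fixes k N :: nat and lam :: "nat \<Rightarrow> real"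
  assumes "k \<ge> 1" and "N \<ge> 2 * k + 1"
    and "\<And>j. j \<in> {1..k} \<Longrightarrow> \<bar>lam j\<bar> < 1"
  shows "hilbert_metric N (Theta_diag N k lam)
    \<and> diagonal_mat (Theta_diag N k lam)
    \<and> ((\<exists>j \<in> {1..k}. lam j \<noteq> 0) \<longrightarrow> Theta_diag N k lam \<noteq> 1\<^sub>m N)
    \<and> self_adjoint_wrt N (Theta_diag N k lam) (H_mat N k lam)
    \<and> transpose_mat (H_mat N k lam) * Theta_diag N k lam
        = Theta_diag N k lam * H_mat N k lam"
proof -
  have H: "H_mat N k lam \<in> carrier_mat N N"
    by (simp add: H_mat_def)
  have T: "Theta_diag N k lam \<in> carrier_mat N N"
    by (simp add: Theta_diag_def)
  have intertwines: "transpose_mat (H_mat N k lam) * Theta_diag N k lam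
      = Theta_diag N k lam * H_mat N k lam"
  proof (rule eq_matI)
    fix r c
    assume "r < dim_row (Theta_diag N k lam * H_mat N k lam)"
      and "c < dim_col (Theta_diag N k lam * H_mat N k lam)"
    then have "r < N" "c < N"
      using H T by auto
    \<comment> \<open>A diagonal factor on the right scales columns, on the left rows, so each entry
      of the matrix identity is one instance of the balance condition.\<close>
    then show "(transpose_mat (H_mat N k lam) * Theta_diag N k lam) $$ (r, c) =
        (Theta_diag N k lam * H_mat N k lam) $$ (r, c)"
      using Theta_H_balance [OF assms(2,3), where r = "Suc r" and c = "Suc c"] H
      by (simp add: Theta_diag_eq_mat_diag mat_diag_mult_left [of _ N N]
          mat_diag_mult_right [of _ N N] H_mat_def mult.commute)
  qed (use H T in auto)
  have "hilbert_metric N (Theta_diag N k lam)"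
    unfolding Theta_diag_eq_mat_diag
    by (intro hilbert_metric_mat_diag Theta_entry_pos assms(3)) auto
  moreover have "diagonal_mat (Theta_diag N k lam)"
    by (auto simp: diagonal_mat_def Theta_diag_def Theta_entry_def)
  \<comment> \<open>If all parameters vanish, every factor is \<open>f_ratio 0 = 1\<close> and the
    metric is the identity; hence the condition.\<close>
  moreover have "Theta_diag N k lam \<noteq> 1\<^sub>m N" if "\<exists>j \<in> {1..k}. lam j \<noteq> 0"
    using assms(2,3) that by (rule Theta_diag_neq_one)
  ultimately show ?thesis
    using self_adjoint_wrt_if_intertwines [OF T H intertwines]
      intertwines
    by blast
qed

end
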